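(* Let $G$ be a connected chordal graph and let $r=r_0,\dots,r_{|r|-1}$ be a separator path in $G$. Then for every $0\le i<|r|-2$, the vertices $r_i$ and $r_{i+2}$ are adjacent.
   Context: A chordal graph is a simple undirected graph in which every cycle with four or more vertices has a chord. A path is a sequence of vertices with consecutive vertices adjacent; $|r|$ is its number of vertices; it is simple if its vertices are distinct; $p_{i,j}$ is the subpath $p_i,\dots,p_j$ and $p$ contains $q$ if $q=p_{i,j}$ for some $i\le j$. A path is separating if removing all of its edges from $G$ disconnects $G$. A separator path is a simple separating path that does not contain any separating path other than itself. *)

theory Defs imports Main begin

definition simple_graph :: "'a set \<Rightarrow> 'a set set \<Rightarrow> bool" where
  "simple_graph V E \<longleftrightarrow> (\<forall>e\<in>E. \<exists>u\<in>V. \<exists>v\<in>V. u \<noteq> v \<and> e = {u, v})"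

text \<open>A path is a nonempty list of vertices that may repeat; its number of vertices is its length.\<close>

definition is_path :: "'a set \<Rightarrow> 'a set set \<Rightarrow> 'a list \<Rightarrow> bool" where
  "is_path V E p \<longleftrightarrow> p \<noteq> [] \<and> set p \<subseteq> V \<and>
     (\<forall>i. Suc i < length p \<longrightarrow> {p ! i, p ! Suc i} \<in> E)"

definition path_edges :: "'a list \<Rightarrow> 'a set set" where
  "path_edges p = {{p ! i, p ! Suc i} | i. Suc i < length p}"

definition graph_connected :: "'a set \<Rightarrow> 'a set set \<Rightarrow> bool" where
  "graph_connected V E \<longleftrightarrow> V \<noteq> {} \<and>
     (\<forall>u\<in>V. \<forall>v\<in>V. \<exists>p. is_path V E p \<and> hd p = u \<and> last p = v)"

text \<open>A cycle lists each of its vertices once; the closing edge joins the last vertex to the first.\<close>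

definition is_cycle :: "'a set \<Rightarrow> 'a set set \<Rightarrow> 'a list \<Rightarrow> bool" where
  "is_cycle V E c \<longleftrightarrow> is_path V E c \<and> distinct c \<and> 3 \<le> length c \<and> {last c, hd c} \<in> E"

definition cycle_edges :: "'a list \<Rightarrow> 'a set set" where
  "cycle_edges c = insert {last c, hd c} (path_edges c)"

definition is_chord :: "'a set set \<Rightarrow> 'a list \<Rightarrow> 'a set \<Rightarrow> bool" where
  "is_chord E c e \<longleftrightarrow> e \<in> E \<and> e \<subseteq> set c \<and> e \<notin> cycle_edges c"

definition chordal_graph :: "'a set \<Rightarrow> 'a set set \<Rightarrow> bool" where
  "chordal_graph V E \<longleftrightarrow> simple_graph V E \<and>
     (\<forall>c. is_cycle V E c \<and> 4 \<le> length c \<longrightarrow> (\<exists>e. is_chord E c e))"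

text \<open>The subpath from index \<open>i\<close> to index \<open>j\<close>, both inclusive.\<close>

definition subpath :: "'a list \<Rightarrow> nat \<Rightarrow> nat \<Rightarrow> 'a list" where
  "subpath p i j = map (\<lambda>k. p ! k) [i..<Suc j]"

definition path_contains :: "'a list \<Rightarrow> 'a list \<Rightarrow> bool" where
  "path_contains p q \<longleftrightarrow> (\<exists>i j. i \<le> j \<and> j < length p \<and> q = subpath p i j)"

text \<open>Only the edges of the path are removed; all vertices stay in the graph.\<close>

definition separating_path :: "'a set \<Rightarrow> 'a set set \<Rightarrow> 'a list \<Rightarrow> bool" where
  "separating_path V E p \<longleftrightarrow> is_path V E p \<and> \<not> graph_connected V (E - path_edges p)"

definition separator_path :: "'a set \<Rightarrow> 'a set set \<Rightarrow> 'a list \<Rightarrow> bool" where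
  "separator_path V E p \<longleftrightarrow> distinct p \<and> separating_path V E p \<and>
     (\<forall>q. path_contains p q \<and> separating_path V E q \<longrightarrow> q = p)"

end

theory Submission imports Defs begin

text \<open>
  Triangles generate the cycle space of a chordal graph, so a set of edges that meets every triangle
  in an even number of edges meets every closed walk in an even number of edges.

  Let \<open>A\<close> be one side of a cut all of whose edges lie on \<open>r\<close>, and suppose that \<open>r\<^sub>i\<close> and \<open>r\<^sub>i\<^sub>+\<^sub>2\<close> are not
  adjacent. A triangle has none or two edges in the cut; in the latter case these are consecutive
  on \<open>r\<close>, and they are not the pair meeting in \<open>r\<^sub>i\<^sub>+\<^sub>1\<close>. Hence the set \<open>S\<close> of cut edges on the segment
  \<open>r\<^sub>0, \<dots>, r\<^sub>i\<^sub>+\<^sub>1\<close> meets every triangle evenly. By minimality of \<open>r\<close>, removing the segment from \<open>r\<^sub>i\<^sub>+\<^sub>1\<close>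
  onwards keeps the graph connected, so \<open>S\<close> is nonempty; removing the segment up to \<open>r\<^sub>i\<^sub>+\<^sub>1\<close> keeps it
  connected as well, so an edge of \<open>S\<close> closes up to a walk with no further edge of \<open>S\<close>, which
  contradicts evenness.
\<close>

section \<open>Walks, and connectivity in terms of cuts\<close>

abbreviation walk :: "'a set set \<Rightarrow> 'a list \<Rightarrow> bool" where
  "walk E \<equiv> successively (\<lambda>x y. {x, y} \<in> E)"

lemma is_path_iff_walk: "is_path V E p \<longleftrightarrow> p \<noteq> [] \<and> set p \<subseteq> V \<and> walk E p"
  by (auto simp: is_path_def successively_conv_nth)

lemma simple_graph_edgeD:
  assumes "simple_graph V E" "{x, y} \<in> E"
  shows "x \<in> V" "y \<in> V" "x \<noteq> y"
  using assms unfolding simple_graph_def by (metis doubleton_eq_iff insert_absorb2)+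

lemma walk_crossing:
  assumes "walk E p" "p \<noteq> []" "hd p \<in> A" "last p \<notin> A"
  shows "\<exists>x\<in>set p \<inter> A. \<exists>y\<in>set p - A. {x, y} \<in> E"
  using assms
proof (induction p rule: induct_list012)
  case (3 x y zs)
  show ?case
  proof (cases "y \<in> A")
    case True
    then show ?thesis using 3 by auto
  next
    case False
    then show ?thesis using 3 by auto
  qed
qed auto

text \<open>A walk from inside \<open>A\<close> to outside it has to cross the cut. Conversely, no
  edge leaves the set of vertices reachable from \<open>u\<close>, so the cut condition forces that
  set to be all of \<open>V\<close>.\<close>

lemma graph_connected_iff_cut:
  "graph_connected V E \<longleftrightarrow>
     V \<noteq> {} \<and> (\<forall>A\<subseteq>V. A \<noteq> {} \<longrightarrow> A \<noteq> V \<longrightarrow> (\<exists>x\<in>A. \<exists>y\<in>V - A. {x, y} \<in> E))"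
  (is "?L \<longleftrightarrow> ?R")
proof
  assume L: ?L
  have "\<exists>x\<in>A. \<exists>y\<in>V - A. {x, y} \<in> E" if A: "A \<subseteq> V" "A \<noteq> {}" "A \<noteq> V" for A
  proof -
    obtain u v where uv: "u \<in> A" "v \<in> V" "v \<notin> A" using A by blast
    then obtain p where p: "is_path V E p" "hd p = u" "last p = v"
      using L A(1) unfolding graph_connected_def by blast
    then show ?thesis
      using walk_crossing[of E p A] uv unfolding is_path_iff_walk by blast
  qed
  then show ?R using L by (auto simp: graph_connected_def)
next
  assume R: ?R
  have "\<exists>p. is_path V E p \<and> hd p = u \<and> last p = v" if uv: "u \<in> V" "v \<in> V" for u v
  proof -
    define A where "A = {x\<in>V. \<exists>p. is_path V E p \<and> hd p = u \<and> last p = x}"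
    have "is_path V E [u]" using uv by (simp add: is_path_iff_walk)
    then have "u \<in> A" using uv unfolding A_def by fastforce
    moreover have "y \<in> A" if xy: "x \<in> A" "y \<in> V" "{x, y} \<in> E" for x y
    proof -
      obtain p where "is_path V E p" "hd p = u" "last p = x"
        using xy(1) by (auto simp: A_def)
      then have "is_path V E (p @ [y])" "hd (p @ [y]) = u"
        using xy by (auto simp: is_path_iff_walk successively_append_iff)
      then show ?thesis using xy(2) unfolding A_def by fastforce
    qed
    moreover have "A \<subseteq> V" by (auto simp: A_def)
    ultimately have "A = V" using R by blast
    then show ?thesis using uv by (auto simp: A_def)
  qed
  then show ?L using R by (auto simp: graph_connected_def)
qed

section \<open>Parity of closed walks in chordal graphs\<close>

fun edge_count :: "'a set set \<Rightarrow> 'a list \<Rightarrow> nat" where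
  "edge_count S (x # y # zs) = of_bool ({x, y} \<in> S) + edge_count S (y # zs)"
| "edge_count S _ = 0"

lemma edge_count_append:
  "edge_count S (xs @ a # ys) = edge_count S (xs @ [a]) + edge_count S (a # ys)"
proof (induction xs rule: induct_list012)
  case (2 x)
  then show ?case by (cases ys) auto
qed auto

lemma edge_count_eq_0:
  assumes "walk E w" "E \<inter> S = {}"
  shows "edge_count S w = 0"
  using assms by (induction w rule: induct_list012) auto

text \<open>A chord is neither a path edge of \<open>c\<close>, which makes \<open>ys\<close>
  nonempty, nor its closing edge, which makes \<open>xs @ zs\<close> nonempty. These two facts
  ensure that cutting along the chord yields two strictly shorter closed walks.\<close>

lemma chord_splits_cycle:
  assumes "is_chord E c {a, b}" "a \<noteq> b"
  obtains xs x ys y zs where "c = xs @ x # ys @ y # zs" "{x, y} \<in> E" "ys \<noteq> []" "xs @ zs \<noteq> []"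
proof -
  have ab: "{a, b} \<in> E" "a \<in> set c" "b \<in> set c" "{a, b} \<notin> cycle_edges c"
    using assms(1) by (auto simp: is_chord_def)
  obtain xs x ys y zs where c: "c = xs @ x # ys @ y # zs" and xy: "{x, y} = {a, b}"
  proof -
    obtain us vs where us: "c = us @ a # vs" using ab(2) by (meson split_list)
    consider "b \<in> set us" | "b \<in> set vs" using ab(3) assms(2) us by auto
    then show ?thesis
    proof cases
      case 1
      then obtain ps qs where "us = ps @ b # qs" by (meson split_list)
      then show ?thesis using that[of ps b qs a vs] us by auto
    next
      case 2
      then obtain ps qs where "vs = ps @ b # qs" by (meson split_list)
      then show ?thesis using that[of us a ps b qs] us by auto
    qed
  qed
  have "ys \<noteq> []"
  proof
    assume "ys = []"
    then have "{x, y} \<in> path_edges c"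
      unfolding path_edges_def c by (auto intro!: exI[of _ "length xs"] simp: nth_append)
    then show False using ab(4) xy by (simp add: cycle_edges_def)
  qed
  moreover have "xs @ zs \<noteq> []"
  proof
    assume "xs @ zs = []"
    then show False using ab(4) xy c by (auto simp: cycle_edges_def insert_commute)
  qed
  ultimately show thesis using that c ab(1) xy by metis
qed

text \<open>Induction on length: a closed walk splits into shorter ones at a repeated vertex or, if
  it is a cycle on at least four vertices, along a chord. What remains are single vertices, edges
  traversed back and forth, and triangles.\<close>

lemma even_edge_count_closed_walk:
  assumes "chordal_graph V E"
    and triangle: "\<And>a b c. {a, b} \<in> E \<Longrightarrow> {b, c} \<in> E \<Longrightarrow> {c, a} \<in> E \<Longrightarrow> even (edge_count S [a, b, c, a])"
    and "walk E w" "w \<noteq> []" "hd w = last w"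
  shows "even (edge_count S w)"
  using assms(3-5)
proof (induction w rule: length_induct)
  case (1 w)
  have simple: "simple_graph V E" using assms(1) by (simp add: chordal_graph_def)
  note IH = 1(1)[rule_format] and w = 1(2-4)
  show ?case
  proof (cases "length w = 1")
    case True
    then show ?thesis by (auto simp: length_Suc_conv)
  next
    case False
    \<comment> \<open>A closed walk lists its start again at the end; \<open>c\<close> drops that
      repetition, so that \<open>distinct c\<close> means that no vertex is revisited in
      between.\<close>
    define c where "c = butlast w"
    have wc: "w = c @ [hd c]" and c0: "c \<noteq> []"
      using w False unfolding c_def
      by (cases w; auto)+
    show ?thesis
    proof (cases "distinct c")
      case False
      then obtain xs ys zs x where c: "c = xs @ [x] @ ys @ [x] @ zs"
        using not_distinct_decomp by blast
      \<comment> \<open>\<open>?u\<close> is the loop between two visits to \<open>x\<close>, and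
        \<open>?v\<close> is the walk with this loop cut out.\<close>
      let ?u = "x # ys @ [x]" and ?v = "xs @ x # zs @ [hd c]"
      have hd: "hd c = hd (xs @ [x])" by (cases xs) (auto simp: c)
      have w_eq: "w = xs @ x # ys @ x # zs @ [hd c]"
        using wc unfolding c by simp
      have "walk E ?u" "walk E ?v"
        using w(1) unfolding w_eq by (auto simp: successively_append_iff successively_Cons hd_append)
      moreover have "hd ?v = last ?v" using hd by (cases xs) auto
      ultimately have "even (edge_count S ?u)" "even (edge_count S ?v)"
        using IH[of ?u] IH[of ?v] by (auto simp: w_eq)
      moreover have "edge_count S w = edge_count S ?u + edge_count S ?v"
        using edge_count_append[of S xs x "ys @ x # zs @ [hd c]"]
          edge_count_append[of S "x # ys" x "zs @ [hd c]"]
          edge_count_append[of S xs x "zs @ [hd c]"]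
        by (simp add: w_eq)
      ultimately show ?thesis by simp
    next
      case distinct: True
      consider "length c = 1" | "length c = 2" | "length c = 3" | "4 \<le> length c"
        using c0 length_greater_0_conv[of c] by linarith
      then show ?thesis
      proof cases
        case 1
        then obtain a where "c = [a]" by (auto simp: length_Suc_conv)
        then have "{a, a} \<in> E" using w(1) wc by simp
        then show ?thesis using simple_graph_edgeD(3)[OF simple] by blast
      next
        case 2
        then obtain a b where "c = [a, b]" by (auto simp: length_Suc_conv numeral_eq_Suc)
        then show ?thesis using wc by (simp add: insert_commute)
      next
        case 3
        then obtain a b d where "c = [a, b, d]" by (auto simp: length_Suc_conv numeral_eq_Suc)
        then show ?thesis using triangle[of a b d] w(1) wc by simp
      next
        case 4
        have "walk E c" and closing: "{last c, hd c} \<in> E"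
          using w(1)[unfolded wc] c0 by (simp_all add: successively_append_iff)
        moreover have "set c \<subseteq> V"
        proof
          fix x assume "x \<in> set c"
          then obtain k where k: "k < length c" "x = c ! k" by (auto simp: in_set_conv_nth)
          then have "Suc k < length w" "w ! k = x"
            by (subst wc, simp add: nth_append)+
          then have "{x, w ! Suc k} \<in> E" using w(1) by (auto simp: successively_conv_nth)
          then show "x \<in> V" using simple_graph_edgeD(1)[OF simple] by blast
        qed
        ultimately have "is_cycle V E c"
          using 4 distinct c0 by (auto simp: is_cycle_def is_path_iff_walk)
        then obtain e where e: "is_chord E c e"
          using assms(1) 4 by (auto simp: chordal_graph_def)
        then obtain a b where "e = {a, b}" "a \<noteq> b"
          using simple by (auto simp: is_chord_def simple_graph_def)
        with e obtain xs x ys y zs where c: "c = xs @ x # ys @ y # zs" "{x, y} \<in> E"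
          and ne: "ys \<noteq> []" "xs @ zs \<noteq> []"
          using chord_splits_cycle by metis
        \<comment> \<open>\<open>?u\<close> closes the detour through \<open>ys\<close> by the
          chord, and \<open>?v\<close> replaces the detour by the chord. Each uses the chord once
          more than \<open>w\<close> does, so the total changes by an even number.\<close>
        let ?u = "x # ys @ [y, x]" and ?v = "xs @ x # y # zs @ [hd c]"
        have hd: "hd c = hd (xs @ [x])" by (cases xs) (auto simp: c)
        have w_eq: "w = xs @ x # ys @ y # zs @ [hd c]"
          using wc unfolding c by simp
        have "walk E ?u" "walk E ?v"
          using w(1) c(2) unfolding w_eq
          by (auto simp: successively_append_iff successively_Cons hd_append insert_commute)
        moreover have "hd ?v = last ?v" using hd by (cases xs) auto
        ultimately have "even (edge_count S ?u)" "even (edge_count S ?v)"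
          using IH[of ?u] IH[of ?v] ne by (auto simp: w_eq)
        moreover have "edge_count S ?u + edge_count S ?v = edge_count S w + 2 * of_bool ({x, y} \<in> S)"
          using edge_count_append[of S xs x "ys @ y # zs @ [hd c]"]
            edge_count_append[of S "x # ys" y "zs @ [hd c]"]
            edge_count_append[of S "x # ys" y "[x]"]
            edge_count_append[of S xs x "y # zs @ [hd c]"]
          by (simp add: w_eq insert_commute)
        ultimately show ?thesis by presburger
      qed
    qed
  qed
qed

section \<open>Subpaths of a separator path\<close>

lemma length_subpath: "length (subpath p i j) = Suc j - i"
  by (simp add: subpath_def del: upt_Suc)

lemma nth_subpath: "k < Suc j - i \<Longrightarrow> subpath p i j ! k = p ! (i + k)"
  by (simp add: subpath_def del: upt_Suc)

lemma path_edges_subpath: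
  "path_edges (subpath p i j) = {{p ! k, p ! Suc k} | k. i \<le> k \<and> k < j}"
proof -
  have "\<exists>k. e = {subpath p i j ! k, subpath p i j ! Suc k} \<and> Suc k < length (subpath p i j)"
    if "e = {p ! k, p ! Suc k}" "i \<le> k" "k < j" for e k
    using that by (intro exI[of _ "k - i"]) (auto simp: length_subpath nth_subpath Suc_diff_le)
  moreover have "\<exists>k. e = {p ! k, p ! Suc k} \<and> i \<le> k \<and> k < j"
    if "e = {subpath p i j ! k, subpath p i j ! Suc k}" "Suc k < length (subpath p i j)" for e k
    using that by (intro exI[of _ "i + k"]) (auto simp: length_subpath nth_subpath)
  ultimately show ?thesis unfolding path_edges_def by blast
qed

lemma is_path_subpath:
  assumes "is_path V E p" "i \<le> j" "j < length p"
  shows "is_path V E (subpath p i j)"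
proof -
  have "set (subpath p i j) \<subseteq> set p"
    using assms(2,3) by (auto simp: subpath_def)
  then show ?thesis
    using assms by (auto simp: is_path_def length_subpath nth_subpath simp flip: length_greater_0_conv)
qed

lemma graph_connected_proper_subpath:
  assumes "separator_path V E r" "i \<le> j" "j < length r" "Suc j - i \<noteq> length r"
  shows "graph_connected V (E - path_edges (subpath r i j))"
proof -
  have "is_path V E (subpath r i j)" "path_contains r (subpath r i j)" "subpath r i j \<noteq> r"
    using assms is_path_subpath length_subpath[of r i j]
    by (auto simp: separator_path_def separating_path_def path_contains_def)
  then show ?thesis
    using assms(1) by (auto simp: separator_path_def separating_path_def)
qed

text \<open>If \<open>{b, c}\<close> came after the segment, distinctness would leave
  \<open>r ! Suc i\<close> as the only possible shared vertex \<open>b\<close>. Then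
  \<open>a\<close> and \<open>c\<close> would be \<open>r ! i\<close> and
  \<open>r ! (i + 2)\<close>, which are not adjacent.\<close>

lemma path_edges_adjacent_in_segment:
  assumes "distinct r" "i + 2 < length r" "{r ! i, r ! (i + 2)} \<notin> E"
    and ab: "{a, b} \<in> path_edges (subpath r 0 (Suc i))"
    and bc: "{b, c} \<in> path_edges r"
    and ac: "{c, a} \<in> E"
  shows "{b, c} \<in> path_edges (subpath r 0 (Suc i))"
proof (rule ccontr)
  assume not_seg: "{b, c} \<notin> path_edges (subpath r 0 (Suc i))"
  obtain k where k: "{a, b} = {r ! k, r ! Suc k}" "k \<le> i"
    using ab by (auto simp: path_edges_subpath less_Suc_eq_le)
  obtain l where l: "{b, c} = {r ! l, r ! Suc l}" "Suc l < length r"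
    using bc by (auto simp: path_edges_def)
  have "i < l" using not_seg l(1) by (force simp: path_edges_subpath)
  have "b = r ! k \<or> b = r ! Suc k" "b = r ! l \<or> b = r ! Suc l"
    using k(1) l(1) by (metis doubleton_eq_iff)+
  then have b: "b = r ! Suc k" "l = Suc k"
    using assms(1,2) k(2) l(2) \<open>i < l\<close> by (auto simp: nth_eq_iff_index_eq)
  then have "k = i" using k(2) \<open>i < l\<close> by simp
  then have "a = r ! i" "c = r ! (i + 2)"
    using b k(1) l(1) by (auto simp: doubleton_eq_iff)
  then show False using ac assms(3) by (simp add: insert_commute)
qed

theorem theorem6:
  fixes V :: "'a set" and E :: "'a set set" and r :: "'a list"
  assumes "chordal_graph V E"
    and "graph_connected V E"
    and "separator_path V E r"
  shows "\<forall>i. i + 2 < length r \<longrightarrow> {r ! i, r ! (i + 2)} \<in> E"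
proof (intro allI impI, rule ccontr)
  fix i assume i: "i + 2 < length r" and nonadj: "{r ! i, r ! (i + 2)} \<notin> E"
  have simple: "simple_graph V E" using assms(1) by (simp add: chordal_graph_def)
  have r: "distinct r" "\<not> graph_connected V (E - path_edges r)"
    using assms(3) by (auto simp: separator_path_def separating_path_def)
  have "V \<noteq> {}" using assms(2) by (simp add: graph_connected_def)
  then obtain A where A: "A \<subseteq> V" "A \<noteq> {}" "A \<noteq> V"
    and cut: "\<And>x y. x \<in> A \<Longrightarrow> y \<in> V - A \<Longrightarrow> {x, y} \<in> E \<Longrightarrow> {x, y} \<in> path_edges r"
    using r(2) unfolding graph_connected_iff_cut by blast
  \<comment> \<open>The two segments share only the vertex \<open>r ! Suc i\<close>, and both are
    shorter than \<open>r\<close> because \<open>i + 2 < length r\<close>.\<close>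
  let ?P = "path_edges (subpath r 0 (Suc i))"
  let ?Q = "path_edges (subpath r (Suc i) (length r - 1))"
  have conP: "graph_connected V (E - ?P)"
    by (rule graph_connected_proper_subpath[OF assms(3)]) (use i in auto)
  have conQ: "graph_connected V (E - ?Q)"
    by (rule graph_connected_proper_subpath[OF assms(3)]) (use i in auto)
  have PQ: "e \<in> ?P" if e: "e \<in> path_edges r" "e \<notin> ?Q" for e
  proof -
    obtain k where k: "e = {r ! k, r ! Suc k}" "Suc k < length r"
      using e(1) by (auto simp: path_edges_def)
    have "k < Suc i"
    proof (rule ccontr)
      assume "\<not> k < Suc i"
      then have "Suc i \<le> k \<and> k < length r - 1" using k(2) by linarith
      then show False using e(2) k(1) unfolding path_edges_subpath by blast
    qed
    then show ?thesis using k(1) unfolding path_edges_subpath by blast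
  qed
  define S where "S = {{x, y} | x y. x \<in> A \<and> y \<in> V - A} \<inter> ?P"
  have S_iff: "{x, y} \<in> S \<longleftrightarrow> (x \<in> A) \<noteq> (y \<in> A) \<and> {x, y} \<in> ?P" if "{x, y} \<in> E" for x y
  proof -
    have "x \<in> V" "y \<in> V" using simple_graph_edgeD[OF simple that] by auto
    then show ?thesis unfolding S_def by (auto simp: doubleton_eq_iff)
  qed
  have cut': "{x, y} \<in> path_edges r" if "{x, y} \<in> E" "(x \<in> A) \<noteq> (y \<in> A)" for x y
    using cut[of x y] cut[of y x] simple_graph_edgeD[OF simple that(1)] that
    by (auto simp: insert_commute)
  \<comment> \<open>Both edges cross the cut and hence lie on \<open>r\<close>, so the segment lemma
    applies from either one to the other.\<close>
  have pair: "{a, b} \<in> ?P \<longleftrightarrow> {b, c} \<in> ?P"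
    if "{a, b} \<in> E" "{b, c} \<in> E" "{c, a} \<in> E" "(a \<in> A) \<noteq> (b \<in> A)" "(b \<in> A) \<noteq> (c \<in> A)" for a b c
    using path_edges_adjacent_in_segment[OF r(1) i nonadj, of a b c]
      path_edges_adjacent_in_segment[OF r(1) i nonadj, of c b a] cut'[of a b] cut'[of b c] that
    by (auto simp: insert_commute)
  have triangle: "even (edge_count S [a, b, c, a])"
    if t: "{a, b} \<in> E" "{b, c} \<in> E" "{c, a} \<in> E" for a b c
    \<comment> \<open>The rotations of \<open>t\<close> cover each choice of the vertex at which the
      two cut edges meet.\<close>
    using pair[OF t] pair[OF t(2,3,1)] pair[OF t(3,1,2)] S_iff[OF t(1)] S_iff[OF t(2)] S_iff[OF t(3)]
    by auto
  obtain x y where xy: "x \<in> A" "y \<in> V - A" "{x, y} \<in> E - ?Q"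
    using conQ A unfolding graph_connected_iff_cut by blast
  then have "{x, y} \<in> S" using cut PQ S_iff by blast
  obtain p where p: "is_path V (E - ?P) p" "hd p = y" "last p = x"
    using conP xy A(1) unfolding graph_connected_def by blast
  then have p': "p \<noteq> []" "walk (E - ?P) p" by (auto simp: is_path_iff_walk)
  then have "walk E p" by (auto elim: successively_mono)
  \<comment> \<open>The walk \<open>x # p\<close> steps from \<open>x\<close> to \<open>y\<close>
    along an edge of \<open>S\<close> and returns to \<open>x\<close> along \<open>p\<close>, which
    avoids \<open>?P\<close> and hence \<open>S\<close>.\<close>
  then have "even (edge_count S (x # p))"
    using xy p p' by (intro even_edge_count_closed_walk[OF assms(1) triangle])
      (auto simp: successively_Cons)
  moreover have "edge_count S p = 0"
    by (rule edge_count_eq_0[OF p'(2)]) (auto simp: S_def)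
  then have "edge_count S (x # p) = 1"
    using p(2) p'(1) \<open>{x, y} \<in> S\<close> by (cases p) auto
  ultimately show False by simp
qed

end
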